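(* Let $G=(S,T;E)$ with $S=\{s_1,\dots,s_n\}$, $T=\{t_1,\dots,t_k\}$ and $d\in\mathbb Z_+$. Consider the algorithm $T$-Greedy: start with $M=\emptyset$ and the set of covered nodes $C=\emptyset$; for $j=1,\dots,k$: set $M_j=\emptyset$, $C_j=\emptyset$, $i=1$, and while $i\le n$, if $s_it_j\in E$ and $s_i\notin C$ then add $s_it_j$ to $M_j$, add $s_i$ to $C_j$ and set $i:=i+d$, otherwise set $i:=i+1$; afterwards set $M:=M\cup M_j$ and $C:=C\cup C_j$. Output $M$. Then the output $M$ is a $d$-distance matching with $2|M|\ge|M^*|$ for every $d$-distance matching $M^*$ of $G$; i.e., $T$-Greedy is a $2$-approximation algorithm for the maximum-cardinality $d$-distance matching problem.
   Context: $G$ is a finite bipartite graph without loops or parallel edges; the nodes of $S$ are in the fixed order $s_1,\dots,s_n$. A $d$-distance matching is a subset $M\subseteq E$ such that every node of $S$ is incident to at most one edge of $M$, and whenever $s_it,s_jt\in M$ with $i\ne j$, $t\in T$, we have $|j-i|\ge d$. *)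

theory Defs
  imports Main "HOL-Library.While_Combinator"
begin

text \<open>
  A simple bipartite graph with colour classes \<open>S\<close> and \<open>T\<close> is given by an edge set
  \<open>E \<subseteq> S \<times> T\<close>, the pair \<open>(u, v)\<close> being the edge between \<open>u \<in> S\<close> and \<open>v \<in> T\<close>.
  The order of the nodes is given by enumerations \<open>s\<close> and \<open>t\<close> on \<open>{1..n}\<close> and \<open>{1..k}\<close>.
\<close>

definition d_distance_matching ::
    "nat \<Rightarrow> nat \<Rightarrow> (nat \<Rightarrow> 's) \<Rightarrow> 't set \<Rightarrow> ('s \<times> 't) set \<Rightarrow> ('s \<times> 't) set \<Rightarrow> bool" where
  "d_distance_matching d n s T E M \<longleftrightarrow>
     M \<subseteq> E \<and>
     (\<forall>u \<in> s ` {1..n}. \<exists>\<^sub>\<le>\<^sub>1 e. e \<in> M \<and> fst e = u) \<and>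
     (\<forall>i \<in> {1..n}. \<forall>j \<in> {1..n}. \<forall>v \<in> T.
        (s i, v) \<in> M \<and> (s j, v) \<in> M \<and> i \<noteq> j \<longrightarrow> \<bar>int j - int i\<bar> \<ge> int d)"

text \<open>
  The inner loop, for a fixed node \<open>v \<in> T\<close>; its state is \<open>(M\<^sub>j, C\<^sub>j, i)\<close>. The set \<open>C\<close> of nodes
  covered in earlier rounds does not change during the loop. It terminates if \<open>d > 0\<close>.
\<close>

definition T_greedy_round ::
    "nat \<Rightarrow> nat \<Rightarrow> (nat \<Rightarrow> 's) \<Rightarrow> ('s \<times> 't) set \<Rightarrow> 's set \<Rightarrow> 't \<Rightarrow> ('s \<times> 't) set \<times> 's set \<times> nat" where
  "T_greedy_round d n s E C v =
     while (\<lambda>(Mj, Cj, i). i \<le> n)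
       (\<lambda>(Mj, Cj, i).
          if (s i, v) \<in> E \<and> s i \<notin> C
          then (insert (s i, v) Mj, insert (s i) Cj, i + d)
          else (Mj, Cj, i + 1))
       ({}, {}, 1)"

definition T_greedy ::
    "nat \<Rightarrow> nat \<Rightarrow> (nat \<Rightarrow> 's) \<Rightarrow> nat \<Rightarrow> (nat \<Rightarrow> 't) \<Rightarrow> ('s \<times> 't) set \<Rightarrow> ('s \<times> 't) set" where
  "T_greedy d n s k t E =
     fst (fold (\<lambda>j (M, C). case T_greedy_round d n s E C (t j) of (Mj, Cj, i) \<Rightarrow> (M \<union> Mj, C \<union> Cj))
            [1..<k + 1] ({}, {}))"

end

theory Submission
  imports Defs
begin

text \<open>
  Let \<open>M\<close> be the output and \<open>M'\<close> any \<open>d\<close>-distance matching. The edges of \<open>M'\<close> whose end in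
  \<open>S\<close> is covered by \<open>M\<close> are at most \<open>card M\<close> many. For an edge \<open>(s i, v)\<close> of \<open>M'\<close> whose end \<open>s i\<close>
  is not covered, the round of \<open>v\<close> can have skipped \<open>i\<close> only because of an edge \<open>(s b, v)\<close> of \<open>M\<close>
  with \<open>b \<le> i < b + d\<close>. Charging \<open>(s i, v)\<close> to \<open>(s b, v)\<close> is injective, because two edges of \<open>M'\<close>
  at \<open>v\<close> have distance at least \<open>d\<close>; so there are at most \<open>card M\<close> such edges as well.
\<close>

section \<open>One round of the algorithm\<close>

text \<open>A loop invariant on the set \<open>I\<close> of chosen indices: a jump by
  \<open>d\<close> keeps chosen indices apart, and an available index is passed over only inside
  such a jump. The hypothesis on \<open>d\<close> makes the loop terminate.\<close>

lemma T_greedy_round_indices: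
  fixes s :: "nat \<Rightarrow> 'a" and v :: 'b
  assumes "d \<ge> 1"
  obtains I i where
    "T_greedy_round d n s E C v = ((\<lambda>a. (s a, v)) ` I, s ` I, i)"
    "I \<subseteq> {1..n}"
    "\<And>a. a \<in> I \<Longrightarrow> (s a, v) \<in> E \<and> s a \<notin> C"
    "\<And>a b. a \<in> I \<Longrightarrow> b \<in> I \<Longrightarrow> a < b \<Longrightarrow> a + d \<le> b"
    "\<And>a. a \<in> {1..n} \<Longrightarrow> (s a, v) \<in> E \<Longrightarrow> s a \<notin> C \<Longrightarrow> \<exists>b\<in>I. b \<le> a \<and> a < b + d"
proof -
  \<comment> \<open>The bound \<open>a + d \<le> i\<close> allows \<open>i\<close> itself to be
    chosen next. The last clause speaks only of the indices below \<open>i\<close>; on exit,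
    \<open>n < i\<close> extends it to all of \<open>{1..n}\<close>.\<close>
  define inv where "inv = (\<lambda>I i. I \<subseteq> {1..n} \<and> 1 \<le> i \<and> (\<forall>a\<in>I. a + d \<le> i) \<and>
      (\<forall>a\<in>I. (s a, v) \<in> E \<and> s a \<notin> C) \<and>
      (\<forall>a\<in>I. \<forall>b\<in>I. a < b \<longrightarrow> a + d \<le> b) \<and>
      (\<forall>a. 1 \<le> a \<and> a < i \<and> (s a, v) \<in> E \<and> s a \<notin> C \<longrightarrow> (\<exists>b\<in>I. b \<le> a \<and> a < b + d)))"
  define P where "P = (\<lambda>(Mj, Cj, i). \<exists>I. Mj = (\<lambda>a. (s a, v)) ` I \<and> Cj = s ` I \<and> inv I i)"
  have select: "inv (insert i I) (i + d)"
    if "inv I i" "i \<le> n" "(s i, v) \<in> E" "s i \<notin> C" for I i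
  proof -
    have "\<forall>a\<in>insert i I. \<forall>b\<in>insert i I. a < b \<longrightarrow> a + d \<le> b"
      using that(1) unfolding inv_def by fastforce
    \<comment> \<open>The witness is the old one if \<open>a < i\<close>, and \<open>i\<close>
      itself otherwise.\<close>
    moreover have "\<exists>b\<in>insert i I. b \<le> a \<and> a < b + d"
      if "1 \<le> a" "a < i + d" "(s a, v) \<in> E" "s a \<notin> C" for a
      using that \<open>inv I i\<close> unfolding inv_def by (cases "a < i") auto
    ultimately show ?thesis
      using that assms unfolding inv_def by (auto intro: trans_le_add1)
  qed
  have skip: "inv I (i + 1)" if "inv I i" "\<not> ((s i, v) \<in> E \<and> s i \<notin> C)" for I i
    using that unfolding inv_def by (auto simp: less_Suc_eq)
  let ?Q = "\<lambda>x. P x \<and> n < snd (snd x)"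
  have "?Q (T_greedy_round d n s E C v)"
    unfolding T_greedy_round_def
  \<comment> \<open>As long as \<open>i \<le> n\<close>, the measure \<open>n + 1 - i\<close> is
    positive, so it drops even when \<open>i + d\<close> overshoots \<open>n\<close>.\<close>
  proof (rule while_rule[where P = P and r = "measure (\<lambda>(Mj, Cj, i). n + 1 - i)"])
    show "P ({}, {}, 1)"
      by (auto simp: P_def inv_def)
  next
    fix x assume "P x" and le: "case x of (Mj, Cj, i) \<Rightarrow> i \<le> n"
    then obtain I i where x: "x = ((\<lambda>a. (s a, v)) ` I, s ` I, i)" "inv I i"
      by (auto simp: P_def)
    show "P (case x of (Mj, Cj, i) \<Rightarrow>
          if (s i, v) \<in> E \<and> s i \<notin> C
          then (insert (s i, v) Mj, insert (s i) Cj, i + d)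
          else (Mj, Cj, i + 1))"
    proof (cases "(s i, v) \<in> E \<and> s i \<notin> C")
      case True
      with x le have "inv (insert i I) (i + d)"
        by (intro select) auto
      with True show ?thesis
        unfolding P_def x(1) by (auto intro!: exI[of _ "insert i I"])
    next
      case False
      with x have "inv I (i + 1)"
        by (intro skip)
      with False show ?thesis
        unfolding P_def x(1) by (auto intro!: exI[of _ I])
    qed
  next
    fix x assume "P x" "\<not> (case x of (Mj, Cj, i) \<Rightarrow> i \<le> n)"
    then show "?Q x"
      by (auto split: prod.splits)
  next
    show "wf (measure (\<lambda>(Mj :: ('a \<times> 'b) set, Cj :: 'a set, i). n + 1 - i))"
      by simp
  next
    fix x :: "('a \<times> 'b) set \<times> 'a set \<times> nat"
    assume "case x of (Mj, Cj, i) \<Rightarrow> i \<le> n"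
    with assms show "(case x of (Mj, Cj, i) \<Rightarrow>
          if (s i, v) \<in> E \<and> s i \<notin> C
          then (insert (s i, v) Mj, insert (s i) Cj, i + d)
          else (Mj, Cj, i + 1), x) \<in> measure (\<lambda>(Mj, Cj, i). n + 1 - i)"
      by (cases x) auto
  qed
  then obtain I i where "T_greedy_round d n s E C v = ((\<lambda>a. (s a, v)) ` I, s ` I, i)"
      "inv I i" "n < i"
    by (cases "T_greedy_round d n s E C v") (auto simp: P_def)
  then show ?thesis
    by (intro that[of I i]) (auto simp: inv_def)
qed

section \<open>Properties preserved over the rounds\<close>

text \<open>Ordering the two indices frees the distance condition from integers and absolute
  values.\<close>

definition separated :: "nat \<Rightarrow> nat \<Rightarrow> (nat \<Rightarrow> 's) \<Rightarrow> ('s \<times> 't) set \<Rightarrow> bool" where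
  "separated d n s M \<longleftrightarrow>
     (\<forall>a\<in>{1..n}. \<forall>b\<in>{1..n}. \<forall>v. (s a, v) \<in> M \<and> (s b, v) \<in> M \<and> a < b \<longrightarrow> a + d \<le> b)"

text \<open>The weak maximality that greedy choice guarantees and the count needs. The parameter
  \<open>V\<close> stands for the nodes processed so far.\<close>

definition saturated ::
    "nat \<Rightarrow> nat \<Rightarrow> (nat \<Rightarrow> 's) \<Rightarrow> ('s \<times> 't) set \<Rightarrow> 't set \<Rightarrow> ('s \<times> 't) set \<Rightarrow> bool" where
  "saturated d n s E V M \<longleftrightarrow>
     (\<forall>a\<in>{1..n}. \<forall>v\<in>V. (s a, v) \<in> E \<and> s a \<notin> fst ` M \<longrightarrow>
        (\<exists>b\<in>{1..n}. b \<le> a \<and> a < b + d \<and> (s b, v) \<in> M))"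

text \<open>The containment puts both ends of every edge into the ranges of the quantifiers in the
  definition, so uniqueness at each node becomes injectivity of \<open>fst\<close>.\<close>

lemma d_distance_matching_iff:
  assumes "M \<subseteq> (s ` {1..n}) \<times> T"
  shows "d_distance_matching d n s T E M \<longleftrightarrow> M \<subseteq> E \<and> inj_on fst M \<and> separated d n s M"
proof -
  have "(\<forall>u \<in> s ` {1..n}. \<exists>\<^sub>\<le>\<^sub>1 e. e \<in> M \<and> fst e = u) \<longleftrightarrow> inj_on fst M"
  proof
    assume L: "\<forall>u \<in> s ` {1..n}. \<exists>\<^sub>\<le>\<^sub>1 e. e \<in> M \<and> fst e = u"
    show "inj_on fst M"
    proof (rule inj_onI)
      fix e f assume "e \<in> M" "f \<in> M" "fst e = fst f"
      moreover have "fst e \<in> s ` {1..n}"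
        using assms \<open>e \<in> M\<close> by auto
      with L have "\<exists>\<^sub>\<le>\<^sub>1 g. g \<in> M \<and> fst g = fst e"
        by (rule bspec)
      ultimately show "e = f"
        unfolding Uniq_def by metis
    qed
  next
    assume "inj_on fst M"
    then show "\<forall>u \<in> s ` {1..n}. \<exists>\<^sub>\<le>\<^sub>1 e. e \<in> M \<and> fst e = u"
      unfolding Uniq_def inj_on_def by metis
  qed
  moreover have "(\<forall>i \<in> {1..n}. \<forall>j \<in> {1..n}. \<forall>v \<in> T.
        (s i, v) \<in> M \<and> (s j, v) \<in> M \<and> i \<noteq> j \<longrightarrow> \<bar>int j - int i\<bar> \<ge> int d) \<longleftrightarrow> separated d n s M"
    (is "?L \<longleftrightarrow> _")
  proof
    assume L: ?L
    show "separated d n s M"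
      unfolding separated_def
    proof (intro ballI allI impI)
      fix a b v assume ab: "a \<in> {1..n}" "b \<in> {1..n}"
        and *: "(s a, v) \<in> M \<and> (s b, v) \<in> M \<and> a < b"
      with assms have "v \<in> T" by auto
      with L ab * have "\<bar>int b - int a\<bar> \<ge> int d" by (metis less_irrefl)
      with * show "a + d \<le> b" by linarith
    qed
  next
    assume R: "separated d n s M"
    show ?L
    proof (intro ballI impI)
      fix i j v assume ij: "i \<in> {1..n}" "j \<in> {1..n}"
        and *: "(s i, v) \<in> M \<and> (s j, v) \<in> M \<and> i \<noteq> j"
      then have "i + d \<le> j \<or> j + d \<le> i"
        using R unfolding separated_def by (meson linorder_neqE_nat)
      then show "\<bar>int j - int i\<bar> \<ge> int d" by linarith
    qed
  qed
  ultimately show ?thesis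
    unfolding d_distance_matching_def by (simp only:)
qed

text \<open>Induction on the processed nodes, the last one split off. A round adds edges only at its
  own node \<open>v\<close> and only to uncovered nodes, so the edges at earlier nodes are
  undisturbed; distinctness leaves a single round for \<open>v\<close>.\<close>

lemma T_greedy_fold:
  assumes "d \<ge> 1" and s: "inj_on s {1..n}" and "distinct vs"
    and "fold (\<lambda>v (M, C). case T_greedy_round d n s E C v of (Mj, Cj, i) \<Rightarrow> (M \<union> Mj, C \<union> Cj))
           vs ({}, {}) = (M, C)"
  shows "C = fst ` M \<and> M \<subseteq> (s ` {1..n}) \<times> set vs \<and> M \<subseteq> E \<and> inj_on fst M \<and>
         separated d n s M \<and> saturated d n s E (set vs) M"
  using assms(3,4)
proof (induction vs arbitrary: M C rule: rev_induct)
  case Nil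
  then show ?case
    by (auto simp: separated_def saturated_def)
next
  case (snoc v vs)
  obtain M0 C0 where fold0:
    "fold (\<lambda>v (M, C). case T_greedy_round d n s E C v of (Mj, Cj, i) \<Rightarrow> (M \<union> Mj, C \<union> Cj))
       vs ({}, {}) = (M0, C0)"
    by fastforce
  with snoc have C0: "C0 = fst ` M0" and sub0: "M0 \<subseteq> (s ` {1..n}) \<times> set vs" and E0: "M0 \<subseteq> E"
    and inj0: "inj_on fst M0" and sep0: "separated d n s M0"
    and sat0: "saturated d n s E (set vs) M0"
    by auto
  obtain I i where round: "T_greedy_round d n s E C0 v = ((\<lambda>a. (s a, v)) ` I, s ` I, i)"
    and I: "I \<subseteq> {1..n}"
    and edge: "\<And>a. a \<in> I \<Longrightarrow> (s a, v) \<in> E \<and> s a \<notin> C0"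
    and sep: "\<And>a b. a \<in> I \<Longrightarrow> b \<in> I \<Longrightarrow> a < b \<Longrightarrow> a + d \<le> b"
    and sat: "\<And>a. a \<in> {1..n} \<Longrightarrow> (s a, v) \<in> E \<Longrightarrow> s a \<notin> C0 \<Longrightarrow> \<exists>b\<in>I. b \<le> a \<and> a < b + d"
    using T_greedy_round_indices[OF assms(1), where n = n and s = s and E = E and C = C0 and v = v]
    by blast
  have M: "M = M0 \<union> (\<lambda>a. (s a, v)) ` I" and C: "C = C0 \<union> s ` I"
    using snoc.prems(2) fold0 round by auto
  have new: "v \<notin> set vs"
    using snoc.prems(1) by simp
  have old_edge: "(u, w) \<in> M \<longleftrightarrow> (u, w) \<in> M0" if "w \<noteq> v" for u w
    using that by (auto simp: M)
  \<comment> \<open>No edge of \<open>M0\<close> ends in \<open>v\<close>, and injectivity of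
    \<open>s\<close> recovers the index from the node.\<close>
  have new_edge: "(s a, v) \<in> M \<longleftrightarrow> a \<in> I" if "a \<in> {1..n}" for a
  proof
    assume "(s a, v) \<in> M"
    then obtain b where "b \<in> I" "s a = s b"
      using sub0 new by (auto simp: M)
    with s that I show "a \<in> I"
      by (metis inj_onD subsetD)
  qed (auto simp: M)
  have "inj_on fst M"
    unfolding M
  proof (rule inj_on_Un[THEN iffD2], intro conjI)
    show "inj_on fst ((\<lambda>a. (s a, v)) ` I)"
      by (auto simp: inj_on_def)
    \<comment> \<open>The round skips \<open>C0\<close>, which is exactly the set of nodes covered
      by \<open>M0\<close>.\<close>
    have "C0 \<inter> s ` I = {}"
      using edge by blast
    then have "fst ` M0 \<inter> fst ` ((\<lambda>a. (s a, v)) ` I) = {}"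
      unfolding C0 image_image fst_conv .
    then show "fst ` (M0 - (\<lambda>a. (s a, v)) ` I) \<inter> fst ` ((\<lambda>a. (s a, v)) ` I - M0) = {}"
      by blast
  qed (rule inj0)
  moreover have "separated d n s M"
    unfolding separated_def
  proof (intro ballI allI impI)
    fix a b w assume ab: "a \<in> {1..n}" "b \<in> {1..n}"
      and *: "(s a, w) \<in> M \<and> (s b, w) \<in> M \<and> a < b"
    show "a + d \<le> b"
    proof (cases "w = v")
      case True
      with ab * show ?thesis
        using sep new_edge by blast
    next
      case False
      with ab * sep0 show ?thesis
        unfolding separated_def by (meson old_edge)
    qed
  qed
  moreover have "saturated d n s E (set (vs @ [v])) M"
    unfolding saturated_def
  proof (intro ballI impI)
    fix a w assume a: "a \<in> {1..n}" and w: "w \<in> set (vs @ [v])"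
      and *: "(s a, w) \<in> E \<and> s a \<notin> fst ` M"
    \<comment> \<open>Coverage only grows, so a node uncovered now was uncovered before the round;
      both \<open>sat\<close> and \<open>sat0\<close> apply to it.\<close>
    then have "s a \<notin> fst ` M0"
      by (auto simp: M)
    show "\<exists>b\<in>{1..n}. b \<le> a \<and> a < b + d \<and> (s b, w) \<in> M"
    proof (cases "w = v")
      case True
      then obtain b where "b \<in> I" "b \<le> a" "a < b + d"
        using sat[OF a] * \<open>s a \<notin> fst ` M0\<close> C0 by blast
      with True I show ?thesis
        using new_edge by blast
    next
      case False
      with w have "w \<in> set vs"
        by simp
      with sat0 a * \<open>s a \<notin> fst ` M0\<close>
      obtain b where "b \<in> {1..n}" "b \<le> a" "a < b + d" "(s b, w) \<in> M0"
        unfolding saturated_def by meson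
      with M show ?thesis
        by blast
    qed
  qed
  ultimately show ?case
    using C0 sub0 E0 I edge by (auto simp: M C image_Un image_image)
qed

section \<open>The factor two\<close>

lemma card_le_twice_saturated:
  assumes "finite M" and s: "inj_on s {1..n}" and sat: "saturated d n s E T M"
    and M': "M' \<subseteq> E" "M' \<subseteq> (s ` {1..n}) \<times> T" "inj_on fst M'" "separated d n s M'"
  shows "card M' \<le> 2 * card M"
proof -
  define A where "A = {e \<in> M'. fst e \<in> fst ` M}"
  define B where "B = {e \<in> M'. fst e \<notin> fst ` M}"
  have "card A = card (fst ` A)"
    \<comment> \<open>Each node of \<open>S\<close> meets at most one edge of \<open>M'\<close>, so
      \<open>A\<close> is counted by its ends in \<open>S\<close>.\<close>
    using M'(3) by (intro card_image[symmetric]) (auto simp: A_def inj_on_def)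
  also have "\<dots> \<le> card (fst ` M)"
    using assms(1) by (intro card_mono) (auto simp: A_def)
  also have "\<dots> \<le> card M"
    using assms(1) by (rule card_image_le)
  finally have A: "card A \<le> card M" .
  \<comment> \<open>A relation, since saturation yields only the existence of a blocking edge; the
    function \<open>g\<close> is chosen from it afterwards.\<close>
  define charge where "charge = (\<lambda>e f. \<exists>a\<in>{1..n}. \<exists>b\<in>{1..n}. \<exists>v.
      e = (s a, v) \<and> f = (s b, v) \<and> b \<le> a \<and> a < b + d \<and> f \<in> M)"
  have "\<exists>f. charge e f" if "e \<in> B" for e
  proof -
    from that M'(2) obtain a v where e: "e = (s a, v)" "a \<in> {1..n}" "v \<in> T"
      by (auto simp: B_def)
    with that M'(1) sat have "\<exists>b\<in>{1..n}. b \<le> a \<and> a < b + d \<and> (s b, v) \<in> M"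
      unfolding saturated_def B_def by auto
    with e show ?thesis
      unfolding charge_def by blast
  qed
  then obtain g where g: "\<And>e. e \<in> B \<Longrightarrow> charge e (g e)"
    by metis
  have "inj_on g B"
  proof (rule inj_onI)
    fix e e' assume ee': "e \<in> B" "e' \<in> B" "g e = g e'"
    obtain a b v where a: "a \<in> {1..n}" "b \<in> {1..n}" "e = (s a, v)" "g e = (s b, v)"
        "b \<le> a" "a < b + d"
      using g[OF ee'(1)] unfolding charge_def by blast
    obtain a' b' v' where a': "a' \<in> {1..n}" "b' \<in> {1..n}" "e' = (s a', v')" "g e' = (s b', v')"
        "b' \<le> a'" "a' < b' + d"
      using g[OF ee'(2)] unfolding charge_def by blast
    \<comment> \<open>Thus \<open>a\<close> and \<open>a'\<close> lie in the same window from
      \<open>b\<close> to \<open>b + d - 1\<close>, where \<open>separated\<close> leaves room for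
      only one edge of \<open>M'\<close> at \<open>v\<close>.\<close>
    have "v' = v" "b' = b"
      using a(2,4) a'(2,4) ee'(3) s by (auto dest: inj_onD)
    moreover have "(s a, v) \<in> M'" "(s a', v') \<in> M'"
      using ee'(1,2) a(3) a'(3) by (auto simp: B_def)
    moreover have "a + d \<le> a'" if "a < a'"
      using M'(4) that a(1) a'(1) calculation unfolding separated_def by blast
    moreover have "a' + d \<le> a" if "a' < a"
      using M'(4) that a(1) a'(1) calculation unfolding separated_def by blast
    ultimately have "a = a'"
      using a(5,6) a'(5,6) by linarith
    with \<open>v' = v\<close> a(3) a'(3) show "e = e'"
      by simp
  qed
  moreover have "g ` B \<subseteq> M"
    using g unfolding charge_def by blast
  ultimately have "card B \<le> card M"
    using assms(1) by (rule card_inj_on_le)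
  moreover have "card M' \<le> card A + card B"
  proof -
    have "M' = A \<union> B"
      by (auto simp: A_def B_def)
    then show ?thesis
      by (simp add: card_Un_le)
  qed
  ultimately show ?thesis
    using A by simp
qed

theorem theorem9:
  fixes S :: "'s set" and T :: "'t set" and E :: "('s \<times> 't) set"
    and s :: "nat \<Rightarrow> 's" and t :: "nat \<Rightarrow> 't" and n k d :: nat
  assumes "bij_betw s {1..n} S" and "bij_betw t {1..k} T"
    and "E \<subseteq> S \<times> T"
    and "d \<ge> 1"
  shows "d_distance_matching d n s T E (T_greedy d n s k t E) \<and>
         (\<forall>M'. d_distance_matching d n s T E M' \<longrightarrow> 2 * card (T_greedy d n s k t E) \<ge> card M')"
proof -
  define M where "M = T_greedy d n s k t E"
  \<comment> \<open>The fold over indices is turned into one over the nodes themselves, listed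
    without repetition because \<open>t\<close> is a bijection.\<close>
  define vs where "vs = map t [1..<k + 1]"
  have "set [1..<k + 1] = {1..k}"
    by auto
  with assms(2) have vs: "distinct vs" "set vs = T"
    unfolding vs_def distinct_map set_map bij_betw_def by simp_all
  have s: "inj_on s {1..n}" "s ` {1..n} = S"
    using assms(1) by (auto simp: bij_betw_def)
  let ?fold = "fold (\<lambda>v (M, C). case T_greedy_round d n s E C v of
      (Mj, Cj, i) \<Rightarrow> (M \<union> Mj, C \<union> Cj)) vs ({}, {})"
  have "M = fst ?fold"
    unfolding M_def T_greedy_def vs_def fold_map comp_def ..
  then have "?fold = (M, snd ?fold)"
    by simp
  from T_greedy_fold[OF assms(4) s(1) vs(1) this]
  have M: "M \<subseteq> (s ` {1..n}) \<times> T" "M \<subseteq> E" "inj_on fst M" "separated d n s M"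
      "saturated d n s E T M"
    by (simp_all add: vs(2))
  have "finite T"
    using vs(2) by auto
  with M(1) have "finite M"
    by (meson finite_SigmaI finite_atLeastAtMost finite_imageI finite_subset)
  have "card M' \<le> 2 * card M" if "d_distance_matching d n s T E M'" for M'
  proof -
    have "M' \<subseteq> E"
      using that by (simp add: d_distance_matching_def)
    with assms(3) s(2) have sub: "M' \<subseteq> (s ` {1..n}) \<times> T"
      by auto
    from that have "inj_on fst M'" "separated d n s M'"
      by (simp_all only: d_distance_matching_iff[OF sub])
    with \<open>finite M\<close> s(1) M(5) \<open>M' \<subseteq> E\<close> sub show ?thesis
      by (rule card_le_twice_saturated)
  qed
  with M show ?thesis
    unfolding M_def[symmetric] by (simp add: d_distance_matching_iff)
qed

end
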